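(* Let $p\ge 1$ be an odd integer. The algorithm $\mathcal{A}$ for odd $p$ described in the context (multimodal search for odd $p$), run with growth factor $a=1+\sqrt{\frac{2}{p+1}}$, has competitive ratio $$CR_{\mathcal{A}} = 2p+3+\sqrt{8(p+1)}.$$
   Context: **Problem.** A point-like searcher starts at the origin of the real line at time $0$ and moves with speed at most $1$. A stationary target is at an unknown coordinate at distance $d\ge 1$ from the origin. The searcher has $p$ search modes, and a target is detected only when the searcher passes through its location in the (unknown) correct mode. The searcher may switch direction and mode instantaneously. A coordinate $x$ is *explored* by time $t$ if the searcher has passed through $x$ in each of the $p$ modes at or before time $t$. By convention every $x$ with $|x|<1$ counts as explored at time $0$. Infinitely precise motion, obtained as a limit of back-and-forth motion on arbitrarily small cells, is permitted. **Competitive ratio.** For an algorithm $\mathcal{A}$ (analyzed as if it never stops), let $T_{\mathcal{A}}(x)=\inf\{t\ge 0: x \text{ is explored by time } t\}$, $CR_{\mathcal{A}}(x)=T_{\mathcal{A}}(x)/|x|$, and $CR_{\mathcal{A}}=\sup_x CR_{\mathcal{A}}(x)$, the supremum being effectively over $|x|\ge 1$. **ThoroughSearch for odd $p$.** ThoroughSearch$(x_{init},\delta,p)$, called when the searcher is at $x_{init}\neq 0$ with $\delta>0$: the searcher travels from $x_{init}$ to $x_{init}+\delta\cdot\mathrm{sign}(x_{init})$ (away from the origin) at constant speed $\frac1p$ while searching in all $p$ modes simultaneously, so each point is explored when it is reached. (This is the limit, as the cell size tends to $0$, of sweeping successive small cells $p$ times each at speed $1$, one mode per sweep.) **Algorithm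 for odd $p$** (input: $p$ and a growth factor $a>1$). For rounds $i=0,1,2,\dots$: set $x=(-1)^i a^{i-1}$; go from the origin to $x$ at speed $1$; call ThoroughSearch$(x,\,a^{i+1}-a^{i-1},\,p)$; return to the origin at speed $1$. *)

theory Defs
  imports Complex_Main "HOL-Library.Extended_Real"
begin

text \<open>
  Modes are the numbers below \<open>p\<close>. A searcher's motion is an infinite sequence of legs, each
  traversed at constant speed, starting at time 0. A leg specifies the set of modes that are in
  use as a function of the time elapsed since its start. At each instant an ordinary motion uses
  a single mode; a larger set occurs only on legs that are limits of back-and-forth motion on
  arbitrarily small cells.
\<close>

record leg =
  leg_from :: real
  leg_to :: real
  leg_speed :: real
  leg_modes :: "real \<Rightarrow> nat set"

type_synonym motion = "nat \<Rightarrow> leg"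

definition leg_duration :: "leg \<Rightarrow> real" where
  "leg_duration L = \<bar>leg_to L - leg_from L\<bar> / leg_speed L"

definition leg_pos :: "leg \<Rightarrow> real \<Rightarrow> real" where
  "leg_pos L s = leg_from L + sgn (leg_to L - leg_from L) * leg_speed L * s"

definition leg_start :: "motion \<Rightarrow> nat \<Rightarrow> real" where
  "leg_start A n = (\<Sum>k<n. leg_duration (A k))"

text \<open>Legs are closed time intervals, so at a common endpoint the modes of both legs count.\<close>

definition passes :: "motion \<Rightarrow> nat \<Rightarrow> real \<Rightarrow> real \<Rightarrow> bool" where
  "passes A m x t \<longleftrightarrow>
     (\<exists>n s. 0 \<le> s \<and> s \<le> leg_duration (A n) \<and> t = leg_start A n + s \<and>
            leg_pos (A n) s = x \<and> m \<in> leg_modes (A n) s)"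

definition explored_by :: "nat \<Rightarrow> motion \<Rightarrow> real \<Rightarrow> real \<Rightarrow> bool" where
  "explored_by p A x t \<longleftrightarrow> \<bar>x\<bar> < 1 \<or> (\<forall>m<p. \<exists>u\<le>t. passes A m x u)"

text \<open>The value is \<open>\<infinity>\<close> if \<open>x\<close> is never explored.\<close>

definition exploration_time :: "nat \<Rightarrow> motion \<Rightarrow> real \<Rightarrow> ereal" where
  "exploration_time p A x = Inf {ereal t | t. 0 \<le> t \<and> explored_by p A x t}"

definition competitive_ratio_at :: "nat \<Rightarrow> motion \<Rightarrow> real \<Rightarrow> ereal" where
  "competitive_ratio_at p A x = exploration_time p A x / ereal \<bar>x\<bar>"

text \<open>Points with \<open>0 < \<bar>x\<bar> < 1\<close> have exploration time 0, so they do not affect the supremum.\<close>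

definition competitive_ratio :: "nat \<Rightarrow> motion \<Rightarrow> ereal" where
  "competitive_ratio p A = (SUP x\<in>{x. x \<noteq> 0}. competitive_ratio_at p A x)"

definition transit :: "real \<Rightarrow> real \<Rightarrow> (real \<Rightarrow> nat) \<Rightarrow> leg" where
  "transit x y \<mu> = \<lparr>leg_from = x, leg_to = y, leg_speed = 1, leg_modes = (\<lambda>s. {\<mu> s})\<rparr>"

definition thorough_search :: "real \<Rightarrow> real \<Rightarrow> nat \<Rightarrow> leg" where
  "thorough_search x \<delta> p =
     \<lparr>leg_from = x, leg_to = x + \<delta> * sgn x, leg_speed = 1 / real p, leg_modes = (\<lambda>_. {..<p})\<rparr>"

text \<open>
  Round \<open>i\<close> of the algorithm for odd \<open>p\<close> with growth factor \<open>a\<close> consists of the legs \<open>3 * i\<close>,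
  \<open>3 * i + 1\<close> and \<open>3 * i + 2\<close>. The algorithm does not prescribe the mode used while travelling
  at speed 1, so it is a parameter: \<open>\<mu> n s\<close> is the mode in use when time \<open>s\<close> has elapsed on leg \<open>n\<close>.
\<close>

definition odd_search :: "nat \<Rightarrow> real \<Rightarrow> (nat \<Rightarrow> real \<Rightarrow> nat) \<Rightarrow> motion" where
  "odd_search p a \<mu> n =
     (let i = n div 3;
          x = (-1) ^ i * a powi (int i - 1);
          S = thorough_search x (a ^ (i + 1) - a powi (int i - 1)) p
      in if n mod 3 = 0 then transit 0 x (\<mu> n)
         else if n mod 3 = 1 then S
         else transit (leg_to S) 0 (\<mu> n))"

end

theory Submission imports Defs begin

text \<open>
  A point \<open>(-1)^k * y\<close> with \<open>a^(k-1) < y \<le> a^(k+1)\<close> is not reached before the thorough search of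
  round \<open>k\<close>, so the modes used in transit are irrelevant: it is explored at time
  \<open>S + a^(k-1) + p * (y - a^(k-1))\<close>, where \<open>S\<close> is the duration of the earlier rounds, a geometric
  sum. The ratio to \<open>y\<close> is largest as \<open>y\<close> tends to \<open>a^(k-1)\<close> from above, and then increases with
  \<open>k\<close> to the limit \<open>((p + 1) * a^2 - (p - 1)) / (a - 1) + 1\<close>.
\<close>

text \<open>Round \<open>i\<close> lasts \<open>a ^ i * ((p + 1) * a - (p - 1) / a)\<close>; this is
  the geometric sum over \<open>i < k\<close>.\<close>

definition round_start :: "nat \<Rightarrow> real \<Rightarrow> nat \<Rightarrow> real" where
  "round_start p a k = ((real p + 1) * a - (real p - 1) / a) * (a ^ k - 1) / (a - 1)"

definition odd_search_ratio :: "nat \<Rightarrow> real \<Rightarrow> real" where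
  "odd_search_ratio p a = ((real p + 1) * a\<^sup>2 - (real p - 1)) / (a - 1) + 1"

text \<open>Positions on a leg are convex combinations of its endpoints. Later \<open>c\<close> is
  \<open>(-1) ^ k\<close>, which reflects the line so that the side searched in round
  \<open>k\<close> becomes positive.\<close>

lemma leg_pos_le_max:
  assumes v: "leg_speed L > 0" and s: "0 \<le> s" "s \<le> leg_duration L"
  shows "c * leg_pos L s \<le> max (c * leg_from L) (c * leg_to L)"
proof (cases "leg_to L = leg_from L")
  case True
  then show ?thesis by (simp add: leg_pos_def)
next
  case False
  define d where "d = leg_to L - leg_from L"
  \<comment> \<open>The fraction of the leg covered after time \<open>s\<close>.\<close>
  define u where "u = leg_speed L * s / \<bar>d\<bar>"
  have d: "d \<noteq> 0" using False by (simp add: d_def)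
  have "leg_speed L * s \<le> \<bar>d\<bar>"
    using s v by (simp add: leg_duration_def d_def field_simps)
  then have u: "0 \<le> u" "u \<le> 1"
    using s v d by (auto simp: u_def)
  have "sgn d * leg_speed L * s = u * d"
    using d by (simp add: u_def sgn_if)
  then have "leg_pos L s = (1 - u) * leg_from L + u * leg_to L"
    by (simp add: leg_pos_def d_def algebra_simps)
  then have "c * leg_pos L s = (1 - u) * (c * leg_from L) + u * (c * leg_to L)"
    by (metis distrib_left mult.left_commute)
  also have "\<dots> \<le> max (c * leg_from L) (c * leg_to L)"
    using u by (intro convex_bound_le) auto
  finally show ?thesis .
qed

section \<open>The legs of the algorithm and their durations\<close>

context
  fixes p :: nat and a :: real and \<mu> :: "nat \<Rightarrow> real \<Rightarrow> nat"
  assumes p: "p \<ge> 1" and a: "a > 1"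
begin

lemma powi_int_diff_1: "a powi (int i - 1) = a ^ i / a"
  using a by (simp add: power_int_diff)

lemma odd_search_outbound:
  "odd_search p a \<mu> (3 * i) = transit 0 ((-1) ^ i * a ^ i / a) (\<mu> (3 * i))"
  by (simp add: odd_search_def powi_int_diff_1 Let_def)

lemma sgn_turn: "sgn ((-1) ^ i * a ^ i / a) = (-1 :: real) ^ i"
  using a by (simp add: sgn_mult power_sgn [symmetric])

lemma odd_search_thorough:
  "odd_search p a \<mu> (Suc (3 * i)) = thorough_search ((-1) ^ i * a ^ i / a) (a ^ (i + 1) - a ^ i / a) p"
proof -
  have "Suc (3 * i) div 3 = i" "Suc (3 * i) mod 3 = 1" by presburger+
  then show ?thesis by (simp add: odd_search_def powi_int_diff_1 Let_def)
qed

lemma leg_to_thorough: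
  "leg_to (odd_search p a \<mu> (Suc (3 * i))) = (-1) ^ i * a ^ (i + 1)"
  unfolding odd_search_thorough thorough_search_def 
  by (simp only: sgn_turn leg.simps) (simp add: algebra_simps)

lemma odd_search_return:
  "odd_search p a \<mu> (Suc (Suc (3 * i))) = transit ((-1) ^ i * a ^ (i + 1)) 0 (\<mu> (Suc (Suc (3 * i))))"
proof -
  have "Suc (Suc (3 * i)) div 3 = i" "Suc (Suc (3 * i)) mod 3 = 2" "Suc (3 * i) div 3 = i" "Suc (3 * i) mod 3 = 1"
    by presburger+
  then show ?thesis
    using leg_to_thorough[of i] by (simp add: odd_search_def Let_def)
qed

lemmas odd_search_legs = odd_search_outbound odd_search_thorough odd_search_return

lemma turn_le: "a ^ i / a \<le> a ^ (i + 1)"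
proof -
  have "a ^ i * 1 \<le> a ^ i * (a * a)"
    using a by (intro mult_left_mono) (auto simp: less_1_mult less_imp_le)
  then show ?thesis using a by (simp add: field_simps)
qed

lemma duration_outbound: "leg_duration (odd_search p a \<mu> (3 * i)) = a ^ i / a"
  using a by (simp add: odd_search_outbound leg_duration_def transit_def abs_mult)

lemma duration_thorough:
  "leg_duration (odd_search p a \<mu> (Suc (3 * i))) = real p * (a ^ (i + 1) - a ^ i / a)"
proof -
  have "leg_to (odd_search p a \<mu> (Suc (3 * i))) - (-1) ^ i * a ^ i / a
        = (-1) ^ i * (a ^ (i + 1) - a ^ i / a)"
    unfolding leg_to_thorough by (simp add: algebra_simps)
  then have "\<bar>leg_to (odd_search p a \<mu> (Suc (3 * i))) - (-1) ^ i * a ^ i / a\<bar> = a ^ (i + 1) - a ^ i / a"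
    using turn_le[of i] by (simp add: abs_mult)
  then show ?thesis
    unfolding leg_duration_def by (simp add: odd_search_thorough thorough_search_def)
qed

lemma duration_return: "leg_duration (odd_search p a \<mu> (Suc (Suc (3 * i)))) = a ^ (i + 1)"
  using a by (simp add: odd_search_return leg_duration_def transit_def abs_mult)

lemma leg_start_round: "leg_start (odd_search p a \<mu>) (3 * k) = round_start p a k"
proof (induction k)
  case 0
  then show ?case by (simp add: leg_start_def round_start_def)
next
  case (Suc k)
  have eq: "3 * Suc k = Suc (Suc (Suc (3 * k)))" by simp
  have "leg_start (odd_search p a \<mu>) (3 * Suc k) = leg_start (odd_search p a \<mu>) (3 * k)
      + leg_duration (odd_search p a \<mu> (3 * k)) + leg_duration (odd_search p a \<mu> (Suc (3 * k)))
      + leg_duration (odd_search p a \<mu> (Suc (Suc (3 * k))))"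
    unfolding eq by (simp add: leg_start_def del: mult_Suc_right)
  also have "\<dots> = round_start p a (Suc k)"
    unfolding Suc duration_outbound duration_thorough duration_return round_start_def
    using a by (simp add: divide_simps) (simp add: algebra_simps)
  finally show ?case .
qed

lemma leg_start_thorough:
  "leg_start (odd_search p a \<mu>) (Suc (3 * k)) = round_start p a k + a ^ k / a"
  using leg_start_round[of k] duration_outbound[of k] by (simp add: leg_start_def)

lemma leg_duration_nonneg: "0 \<le> leg_duration (odd_search p a \<mu> n)"
  by (auto simp: leg_duration_def odd_search_def Let_def transit_def thorough_search_def)

lemma leg_start_mono:
  assumes "m \<le> n"
  shows "leg_start (odd_search p a \<mu>) m \<le> leg_start (odd_search p a \<mu>) n"
  unfolding leg_start_def using assms by (intro sum_mono2) (auto simp: leg_duration_nonneg)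

lemma leg_speed_pos: "leg_speed (odd_search p a \<mu> n) > 0"
  using p by (auto simp: odd_search_def Let_def transit_def thorough_search_def)

section \<open>Positions before the thorough search of round \<open>k\<close>\<close>

text \<open>Round \<open>k - 1\<close> lies on the opposite side, so its signed turning points are
  negative; a round \<open>j \<le> k - 2\<close> gets no farther than
  \<open>a ^ (j + 1) \<le> a ^ (k - 1)\<close> on either side.\<close>

lemma signed_turn_le:
  assumes "j < k"
  shows "(-1) ^ k * ((-1) ^ j * a ^ (j + 1)) \<le> a ^ k / a"
    and "(-1) ^ k * ((-1) ^ j * a ^ j / a) \<le> a ^ k / a"
proof -
  have *: "(-1) ^ k * ((-1) ^ j * a ^ (j + 1)) \<le> a ^ k / a \<and> (-1) ^ k * ((-1) ^ j * a ^ j / a) \<le> a ^ k / a"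
  proof (cases "k = j + 1")
    case True
    have "(-1) ^ k * (-1) ^ j = (-1 :: real)"
      using True by (simp flip: power_add mult_2)
    then have "(-1) ^ k * ((-1) ^ j * a ^ (j + 1)) = - (a ^ (j + 1))"
      "(-1) ^ k * ((-1) ^ j * a ^ j / a) = - (a ^ j / a)"
      by (simp_all flip: mult.assoc)
    moreover have "0 \<le> a ^ (j + 1)" "0 \<le> a ^ j / a" "0 \<le> a ^ k / a" using a by auto
    ultimately show ?thesis by linarith
  next
    case False
    have "a ^ (j + 2) \<le> a ^ k"
      using a False assms by (intro power_increasing) auto
    then have le: "a ^ (j + 1) \<le> a ^ k / a" using a by (simp add: field_simps)
    have sgn: "(-1) ^ k * (-1) ^ j = (1::real) \<or> (-1) ^ k * (-1) ^ j = (-1::real)"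
      by (metis neg_one_even_power neg_one_odd_power power_add)
    have "(-1) ^ k * ((-1) ^ j * y) \<le> y" if "0 \<le> y" for y :: real
      using sgn that by (auto simp flip: mult.assoc)
    from this[of "a ^ (j + 1)"] this[of "a ^ j / a"]
    have "(-1) ^ k * ((-1) ^ j * a ^ (j + 1)) \<le> a ^ (j + 1)"
      "(-1) ^ k * ((-1) ^ j * a ^ j / a) \<le> a ^ j / a"
      using a by simp_all
    then show ?thesis using le turn_le[of j] by linarith
  qed
  show "(-1) ^ k * ((-1) ^ j * a ^ (j + 1)) \<le> a ^ k / a"
    and "(-1) ^ k * ((-1) ^ j * a ^ j / a) \<le> a ^ k / a"
    using * by auto
qed

text \<open>Leg \<open>3 * k\<close> is included because the outbound transit of round
  \<open>k\<close> stops exactly at the bound; every earlier leg ends at 0 or at turning points of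
  rounds \<open>j < k\<close>.\<close>

lemma leg_ends_le:
  assumes "n \<le> 3 * k"
  shows "max ((-1) ^ k * leg_from (odd_search p a \<mu> n)) ((-1) ^ k * leg_to (odd_search p a \<mu> n)) \<le> a ^ k / a"
proof -
  have nn: "0 \<le> a ^ k / a" using a by simp
  have "n = 3 * (n div 3) \<or> n = Suc (3 * (n div 3)) \<or> n = Suc (Suc (3 * (n div 3)))"
    by presburger
  then obtain j where j: "n = 3 * j \<or> n = Suc (3 * j) \<or> n = Suc (Suc (3 * j))" by blast
  consider "j < k" | "n = 3 * k" "j = k" using j assms by linarith
  then show ?thesis
  proof cases
    case 1
    then show ?thesis
      using j signed_turn_le[OF 1] nn leg_to_thorough[of j]
      by (auto simp: odd_search_legs transit_def thorough_search_def simp del: power_Suc)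
  next
    case 2
    have "(-1) ^ k * ((-1) ^ k * a ^ k / a) = a ^ k / a"
      by (simp flip: power_add mult_2 mult.assoc)
    then show ?thesis
      using nn 2 by (simp add: odd_search_outbound transit_def)
  qed
qed

text \<open>By convexity the legs up to \<open>3 * k\<close> stay within their endpoints, hence
  short of \<open>y\<close>, so the passing leg begins no earlier than the thorough search of round
  \<open>k\<close>. The time from there to \<open>y\<close> is dropped: it is negligible for the
  points used in the limit.\<close>

lemma passes_lower:
  assumes "passes (odd_search p a \<mu>) m ((-1) ^ k * y) t" "y > a ^ k / a"
  shows "round_start p a k + a ^ k / a \<le> t"
proof -
  obtain n s where s: "0 \<le> s" "s \<le> leg_duration (odd_search p a \<mu> n)"
    and t: "t = leg_start (odd_search p a \<mu>) n + s"
    and pos: "leg_pos (odd_search p a \<mu> n) s = (-1) ^ k * y"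
    using assms(1) by (auto simp: passes_def)
  have "(-1) ^ k * leg_pos (odd_search p a \<mu> n) s = y"
    unfolding pos by (simp flip: power_add mult_2 mult.assoc)
  then have "\<not> n \<le> 3 * k"
    using leg_pos_le_max[OF leg_speed_pos s, of "(-1) ^ k"] leg_ends_le[of n k] assms(2)
    by linarith
  then have "leg_start (odd_search p a \<mu>) (Suc (3 * k)) \<le> leg_start (odd_search p a \<mu>) n"
    by (intro leg_start_mono) simp
  then show ?thesis using s t leg_start_thorough[of k] by linarith
qed

section \<open>Exploration during the thorough search\<close>

lemma passes_thorough:
  assumes "m < p" "a ^ k / a \<le> y" "y \<le> a ^ (k + 1)"
  shows "passes (odd_search p a \<mu>) m ((-1) ^ k * y)
           (round_start p a k + a ^ k / a + real p * (y - a ^ k / a))"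
  unfolding passes_def
proof (intro exI conjI)
  let ?L = "odd_search p a \<mu> (Suc (3 * k))" and ?s = "real p * (y - a ^ k / a)"
  show "0 \<le> ?s" using assms by simp
  show "?s \<le> leg_duration ?L"
    unfolding duration_thorough using assms by (intro mult_left_mono) auto
  show "round_start p a k + a ^ k / a + ?s = leg_start (odd_search p a \<mu>) (Suc (3 * k)) + ?s"
    by (simp add: leg_start_thorough)
  show "m \<in> leg_modes ?L ?s"
    using assms by (simp add: odd_search_thorough thorough_search_def)
  have from_L: "leg_from ?L = (-1) ^ k * a ^ k / a" and speed_L: "leg_speed ?L = 1 / real p"
    by (simp_all add: odd_search_thorough thorough_search_def)
  have "leg_to ?L - leg_from ?L = (-1) ^ k * (a ^ (k + 1) - a ^ k / a)"
    unfolding leg_to_thorough from_L by (simp add: algebra_simps)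
  \<comment> \<open>Strictness excludes sign 0, for which \<open>leg_pos\<close> would stand
    still.\<close>
  moreover have "a ^ k / a < a ^ (k + 1)"
    using a power_strict_increasing[of k "k + 2" a] by (simp add: field_simps)
  ultimately have "sgn (leg_to ?L - leg_from ?L) = (-1) ^ k"
    by (simp add: sgn_mult power_sgn [symmetric])
  then have "leg_pos ?L ?s = leg_from ?L + (-1) ^ k * leg_speed ?L * ?s"
    by (simp add: leg_pos_def)
  also have "\<dots> = (-1) ^ k * y"
    unfolding from_L speed_L using p by (simp add: algebra_simps)
  finally show "leg_pos ?L ?s = (-1) ^ k * y" .
qed

section \<open>Upper bound on the ratio\<close>

text \<open>With \<open>C\<close> the claimed ratio and \<open>b = a ^ k / a\<close>, the thorough
  search starts at time \<open>C * b - (C - 1) / a\<close>: below \<open>C * b\<close>, and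
  asymptotic to it.\<close>

lemma round_start_eq:
  "round_start p a k = (odd_search_ratio p a - 1) * (a ^ k / a - 1 / a)"
  using a by (simp add: round_start_def odd_search_ratio_def divide_simps power2_eq_square)

text \<open>Exploration time grows with slope \<open>p\<close> during a thorough search, so the
  first bound keeps it below the line of slope \<open>C\<close>; the second makes the factor
  \<open>C - 1\<close> nonnegative.\<close>

lemma odd_search_ratio_ge: "odd_search_ratio p a \<ge> real p" "odd_search_ratio p a \<ge> 1"
proof -
  have "(real p - 1) * (a - 1) * 1 \<le> (real p - 1) * (a - 1) * (a + 1)"
    using p a by (intro mult_left_mono) auto
  also have "\<dots> = (real p - 1) * a\<^sup>2 - (real p - 1)"
    by (simp add: algebra_simps power2_eq_square)
  also have "\<dots> \<le> (real p + 1) * a\<^sup>2 - (real p - 1)"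
    by (simp add: mult_right_mono)
  finally show "odd_search_ratio p a \<ge> real p"
    using a by (simp add: odd_search_ratio_def field_simps)
  then show "odd_search_ratio p a \<ge> 1" using p by linarith
qed

text \<open>Take the least \<open>k\<close> of the right parity whose reach
  \<open>a ^ (k + 1)\<close> covers \<open>x\<close>. Round \<open>k - 2\<close> searches the same
  side up to \<open>a ^ (k - 1)\<close> and failed to cover \<open>x\<close>, which gives the lower
  bound on \<open>y\<close>.\<close>

lemma covering_round:
  assumes "\<bar>x\<bar> \<ge> 1"
  obtains k y where "x = (-1) ^ k * y" "y = \<bar>x\<bar>" "a ^ k / a \<le> y" "y \<le> a ^ (k + 1)"
proof -
  define P where "P k \<longleftrightarrow> x = (-1) ^ k * \<bar>x\<bar> \<and> \<bar>x\<bar> \<le> a ^ (k + 1)" for k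
  obtain n where n: "\<bar>x\<bar> < a ^ n" using a real_arch_pow by blast
  have "\<exists>k. P k"
  proof (cases "x \<ge> 0")
    case True
    have "a ^ n \<le> a ^ (2 * n + 1)" using a by (intro power_increasing) auto
    with n True have "P (2 * n)" by (auto simp: P_def simp del: power_Suc)
    then show ?thesis ..
  next
    case False
    have "a ^ n \<le> a ^ (2 * n + 2)" using a by (intro power_increasing) auto
    with n False have "P (2 * n + 1)" by (auto simp: P_def simp del: power_Suc)
    then show ?thesis ..
  qed
  then obtain k where k: "P k" "\<And>j. j < k \<Longrightarrow> \<not> P j"
    by (metis LeastI not_less_Least)
  have "a ^ k / a \<le> \<bar>x\<bar>"
  proof (cases "k \<ge> 2")
    case True
    then obtain j where j: "k = j + 2" by (metis add.commute le_Suc_ex)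
    then have "\<not> P j" using k(2) by simp
    then show ?thesis using k(1) j a by (auto simp: P_def)
  next
    case False
    \<comment> \<open>No earlier round on this side exists, but the search starts at
      \<open>1 / a\<close> or 1, hence not beyond \<open>x\<close>.\<close>
    then have "k = 0 \<or> k = 1" by linarith
    moreover have "1 / a \<le> 1" using a by simp
    then have "1 / a \<le> \<bar>x\<bar>" using assms by linarith
    ultimately show ?thesis using assms a by auto
  qed
  then show ?thesis using that[of k "\<bar>x\<bar>"] k(1) by (auto simp: P_def)
qed

lemma competitive_ratio_at_le:
  assumes "x \<noteq> 0"
  shows "competitive_ratio_at p (odd_search p a \<mu>) x \<le> ereal (odd_search_ratio p a)"
proof -
  have "\<exists>t\<ge>0. explored_by p (odd_search p a \<mu>) x t \<and> t \<le> odd_search_ratio p a * \<bar>x\<bar>"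
  proof (cases "\<bar>x\<bar> < 1")
    case True
    then show ?thesis
      using odd_search_ratio_ge(2) by (intro exI[of _ 0]) (auto simp: explored_by_def)
  next
    case False
    then obtain k y where y: "x = (-1) ^ k * y" "y = \<bar>x\<bar>" "a ^ k / a \<le> y" "y \<le> a ^ (k + 1)"
      using covering_round[of x] by (metis not_less)
    define t where "t = round_start p a k + a ^ k / a + real p * (y - a ^ k / a)"
    have "explored_by p (odd_search p a \<mu>) x t"
      unfolding explored_by_def y(1) t_def using passes_thorough[OF _ y(3,4)] by blast
    moreover have "0 \<le> round_start p a k"
      unfolding round_start_eq using a odd_search_ratio_ge(2)
      by (intro mult_nonneg_nonneg) (auto simp: divide_right_mono)
    then have "0 \<le> t" using y(3) a by (simp add: t_def)
    moreover have "t \<le> odd_search_ratio p a * \<bar>x\<bar>"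
    proof -
      \<comment> \<open>Split \<open>y\<close> as \<open>b + (y - b)\<close>: reaching
        \<open>b\<close> in round \<open>k\<close> costs at most \<open>C * b\<close>, and the rest
        at most \<open>C * (y - b)\<close>.\<close>
      define b where "b = a ^ k / a"
      have "round_start p a k \<le> (odd_search_ratio p a - 1) * b"
        unfolding round_start_eq b_def using a odd_search_ratio_ge(2) by (intro mult_left_mono) auto
      moreover have "real p * (y - b) \<le> odd_search_ratio p a * (y - b)"
        unfolding b_def using odd_search_ratio_ge(1) y(3) by (intro mult_right_mono) auto
      ultimately show ?thesis
        unfolding t_def y(2)[symmetric] b_def[symmetric] by (simp add: algebra_simps)
    qed
    ultimately show ?thesis by blast
  qed
  then obtain t where t: "0 \<le> t" "explored_by p (odd_search p a \<mu>) x t" "t \<le> odd_search_ratio p a * \<bar>x\<bar>"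
    by blast
  have "exploration_time p (odd_search p a \<mu>) x \<le> ereal t"
    unfolding exploration_time_def using t by (intro Inf_lower) auto
  also have "\<dots> \<le> ereal \<bar>x\<bar> * ereal (odd_search_ratio p a)"
    using t by (simp add: mult.commute)
  finally show ?thesis
    unfolding competitive_ratio_at_def using assms by (subst ereal_divide_le_pos) auto
qed

section \<open>Lower bound and the exact ratio for every growth factor\<close>

lemma competitive_ratio_at_ge:
  assumes y: "y > a ^ k / a" "y \<ge> 1"
  shows "ereal ((round_start p a k + a ^ k / a) / y)
           \<le> competitive_ratio_at p (odd_search p a \<mu>) ((-1) ^ k * y)"
proof -
  have "round_start p a k + a ^ k / a \<le> t" if "explored_by p (odd_search p a \<mu>) ((-1) ^ k * y) t" for t
  proof -
    have "\<not> \<bar>(-1) ^ k * y\<bar> < 1" using y by (simp add: abs_mult)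
    then have "\<forall>m<p. \<exists>u\<le>t. passes (odd_search p a \<mu>) m ((-1) ^ k * y) u"
      using that by (simp add: explored_by_def)
    \<comment> \<open>One mode suffices for the bound; mode 0 exists since
      \<open>p \<ge> 1\<close>.\<close>
    then obtain u where "u \<le> t" "passes (odd_search p a \<mu>) 0 ((-1) ^ k * y) u"
      using p by (metis less_le_trans zero_less_one)
    then show ?thesis using passes_lower[of 0 k y u] y(1) by linarith
  qed
  then have "ereal (round_start p a k + a ^ k / a) \<le> exploration_time p (odd_search p a \<mu>) ((-1) ^ k * y)"
    unfolding exploration_time_def by (intro Inf_greatest) auto
  then have "ereal (round_start p a k + a ^ k / a) / ereal y
      \<le> exploration_time p (odd_search p a \<mu>) ((-1) ^ k * y) / ereal y"
    using y by (intro ereal_divide_right_mono) auto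
  then show ?thesis
    using y by (simp add: competitive_ratio_at_def abs_mult)
qed

theorem competitive_ratio_odd_search:
  "competitive_ratio p (odd_search p a \<mu>) = ereal (odd_search_ratio p a)"
proof (rule antisym)
  show "competitive_ratio p (odd_search p a \<mu>) \<le> ereal (odd_search_ratio p a)"
    unfolding competitive_ratio_def by (intro SUP_least competitive_ratio_at_le) simp
next
  define C where "C = odd_search_ratio p a"
  \<comment> \<open>Points beyond the turning point by a fixed offset, which vanishes relative to
    \<open>a ^ k / a\<close>, so one limit in \<open>k\<close> replaces a double limit. The value
    \<open>1 / a\<close> makes \<open>y k = (a ^ k + 1) / a\<close>.\<close>
  define y where "y k = a ^ k / a + 1 / a" for k
  define r where "r k = (round_start p a k + a ^ k / a) / y k" for k
  have "r = (\<lambda>k. ((C - 1) * (1 - (1 / a) ^ k) + 1) / (1 + (1 / a) ^ k))"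
  proof
    fix k
    have "a ^ k + 1 > 0" using a by (intro add_pos_pos) auto
    then show "r k = ((C - 1) * (1 - (1 / a) ^ k) + 1) / (1 + (1 / a) ^ k)"
      using a unfolding r_def y_def round_start_eq C_def[symmetric]
      by (simp add: divide_simps)
  qed
  moreover have "(\<lambda>k. ((C - 1) * (1 - (1 / a) ^ k) + 1) / (1 + (1 / a) ^ k)) \<longlonglongrightarrow> ((C - 1) * (1 - 0) + 1) / (1 + 0)"
    using a by (intro tendsto_intros LIMSEQ_power_zero) auto
  ultimately have "r \<longlonglongrightarrow> C" by simp
  then have "(\<lambda>k. ereal (r k)) \<longlonglongrightarrow> ereal C" by simp
  \<comment> \<open>For \<open>k = 0\<close> the point \<open>2 / a\<close> may lie in the region
    explored by convention.\<close>
  moreover have "ereal (r k) \<le> competitive_ratio p (odd_search p a \<mu>)" if "k \<ge> 1" for k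
  proof -
    have "a ^ 1 \<le> a ^ k" using that a by (intro power_increasing) auto
    then have "1 \<le> a ^ k / a" using a by simp
    then have y: "y k > a ^ k / a" "y k \<ge> 1" using a by (auto simp: y_def intro: add_increasing2)
    have "competitive_ratio_at p (odd_search p a \<mu>) ((-1) ^ k * y k) \<le> competitive_ratio p (odd_search p a \<mu>)"
      unfolding competitive_ratio_def using y by (intro SUP_upper) auto
    with competitive_ratio_at_ge[OF y] show ?thesis unfolding r_def by (rule order_trans)
  qed
  ultimately have "ereal C \<le> competitive_ratio p (odd_search p a \<mu>)"
    by (meson LIMSEQ_le_const2)
  then show "ereal (odd_search_ratio p a) \<le> competitive_ratio p (odd_search p a \<mu>)"
    by (simp add: C_def)
qed

end

section \<open>Evaluation at the given growth factor\<close>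

theorem theorem1:
  fixes p :: nat and \<mu> :: "nat \<Rightarrow> real \<Rightarrow> nat"
  assumes "p \<ge> 1" and "odd p"
    and "\<And>n s. \<mu> n s < p"
  shows "competitive_ratio p (odd_search p (1 + sqrt (2 / (real p + 1))) \<mu>)
           = ereal (2 * real p + 3 + sqrt (8 * (real p + 1)))"
proof -
  \<comment> \<open>For \<open>a = 1 + s\<close> the ratio is
    \<open>2 * q + 1 + 2 / s + q * s\<close>. The choice \<open>q * s\<^sup>2 = 2\<close> balances
    the last two terms, which minimises their sum and makes it
    \<open>4 / s = sqrt (8 * q)\<close>.\<close>
  define q s where "q = real p + 1" and "s = sqrt (2 / q)"
  have "q > 0" by (simp add: q_def)
  then have s: "s > 0" "q * s\<^sup>2 = 2" by (simp_all add: s_def)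
  have "sqrt (8 * q) = 4 / s"
  proof (rule real_sqrt_unique)
    have "8 * q * s\<^sup>2 = 4\<^sup>2" using s by simp
    then show "(4 / s)\<^sup>2 = 8 * q"
      using s(1) by (simp add: power_divide nonzero_divide_eq_eq)
    show "0 \<le> 4 / s" using s(1) by simp
  qed
  moreover have "odd_search_ratio p (1 + s) = 2 * real p + 3 + 4 / s"
  proof -
    have "(real p + 1) * (1 + s)\<^sup>2 - (real p - 1) = 2 + 2 * (real p + 1) * s + q * s\<^sup>2"
      by (simp add: q_def power2_eq_square algebra_simps)
    then show ?thesis
      unfolding odd_search_ratio_def s(2) using s(1) by (simp add: field_simps)
  qed
  moreover have "competitive_ratio p (odd_search p (1 + s) \<mu>) = ereal (odd_search_ratio p (1 + s))"
    using s(1) assms by (intro competitive_ratio_odd_search) auto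
  ultimately show ?thesis
    unfolding s_def q_def by simp
qed

end
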